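(* Let $X$ be a finite $r$-regular graph. Then $X$ has a non-trivial efficient dominating function, i.e. there exist nonnegative integers $j$ and $k\geq 1$ and a non-constant efficient $(j,k)$-dominating function on $X$, if and only if $-1$ is an eigenvalue of the adjacency matrix of $X$.
   Context: For a graph $X$ and vertex $v$, $N[v]$ denotes the closed neighbourhood of $v$, and for $f:V(X)\to\mathbb{R}$ and $S\subseteq V(X)$, $f(S)=\sum_{u\in S}f(u)$. For nonnegative integers $j,k$, a $(j,k)$-dominating function on $X$ is a function $f:V(X)\to\{0,1,\ldots,j\}$ with $f(N[v])\geq k$ for every vertex $v$; it is efficient if $f(N[v])=k$ for every vertex $v$. An efficient dominating function is called trivial if it is constant on $V(X)$. *)

theory Defs
  imports "Graph_Theory.Digraph" "Jordan_Normal_Form.Char_Poly"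
begin

text \<open>
  A finite simple graph is a \<open>graph\<close> in the sense of \<^theory>\<open>Graph_Theory.Digraph\<close>: a finite
  symmetric digraph without loops and parallel arcs. Each edge is a pair of opposite arcs, so the
  degree of a vertex is its \<^const>\<open>out_degree\<close>.
\<close>

definition regular :: "('a, 'b) pre_digraph \<Rightarrow> nat \<Rightarrow> bool" where
  "regular G r \<longleftrightarrow> (\<forall>v \<in> verts G. out_degree G v = r)"

definition closed_nbhd :: "('a, 'b) pre_digraph \<Rightarrow> 'a \<Rightarrow> 'a set" where
  "closed_nbhd G v = insert v {u. v \<rightarrow>\<^bsub>G\<^esub> u}"

definition dominating_function ::
  "('a, 'b) pre_digraph \<Rightarrow> nat \<Rightarrow> nat \<Rightarrow> ('a \<Rightarrow> nat) \<Rightarrow> bool" where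
  "dominating_function G j k f \<longleftrightarrow>
     (\<forall>v \<in> verts G. f v \<le> j) \<and> (\<forall>v \<in> verts G. (\<Sum>u \<in> closed_nbhd G v. f u) \<ge> k)"

definition efficient_dominating_function ::
  "('a, 'b) pre_digraph \<Rightarrow> nat \<Rightarrow> nat \<Rightarrow> ('a \<Rightarrow> nat) \<Rightarrow> bool" where
  "efficient_dominating_function G j k f \<longleftrightarrow>
     dominating_function G j k f \<and> (\<forall>v \<in> verts G. (\<Sum>u \<in> closed_nbhd G v. f u) = k)"

definition trivial_function :: "('a, 'b) pre_digraph \<Rightarrow> ('a \<Rightarrow> nat) \<Rightarrow> bool" where
  "trivial_function G f \<longleftrightarrow> (\<exists>c. \<forall>v \<in> verts G. f v = c)"

text \<open>
  Rows and columns are ordered by a list \<open>vs\<close>, intended to enumerate the vertices without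
  repetition.
\<close>

definition adjacency_matrix :: "('a, 'b) pre_digraph \<Rightarrow> 'a list \<Rightarrow> real mat" where
  "adjacency_matrix G vs =
     mat (length vs) (length vs) (\<lambda>(i, j). if (vs ! i) \<rightarrow>\<^bsub>G\<^esub> (vs ! j) then 1 else 0)"

end

theory Submission
  imports Defs
begin

text \<open>
  Write \<open>N = A + I\<close> for the closed-neighbourhood matrix, so that \<open>-1\<close> is an eigenvalue of \<open>A\<close> iff
  \<open>N\<close> is singular. Since \<open>N\<close> has integer entries, its determinant vanishes over the reals iff it
  does over the integers, so a real kernel vector can be replaced by an integral one. As
  \<open>N 1 = (r + 1) 1\<close> by regularity, an efficient dominating function \<open>f\<close> yields the kernel vector
  \<open>(r + 1) f - k 1\<close>, which is nonzero when \<open>f\<close> is not constant; conversely an integral kernel vector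
  is not constant, and adding a large constant to it gives an efficient dominating function.
\<close>

definition closed_nbhd_matrix :: "('a, 'b) pre_digraph \<Rightarrow> 'a list \<Rightarrow> int mat" where
  "closed_nbhd_matrix G vs =
     mat (length vs) (length vs) (\<lambda>(i, j). if vs ! j \<in> closed_nbhd G (vs ! i) then 1 else 0)"

lemma closed_nbhd_matrix_carrier [simp]:
  "closed_nbhd_matrix G vs \<in> carrier_mat (length vs) (length vs)"
  by (simp add: closed_nbhd_matrix_def)

lemma (in wf_digraph) closed_nbhd_subset_verts:
  "v \<in> verts G \<Longrightarrow> closed_nbhd G v \<subseteq> verts G"
  by (auto simp: closed_nbhd_def dest: adj_in_verts)

text \<open>Without parallel arcs, \<open>head G\<close> is injective on the arcs leaving
  \<open>v\<close>, so counting arcs counts neighbours; without loops, \<open>v\<close> itself adds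
  one more.\<close>

lemma (in digraph) card_closed_nbhd:
  "card (closed_nbhd G v) = Suc (out_degree G v)"
proof -
  have "inj_on (head G) (out_arcs G v)"
    by (rule inj_onI) (auto simp: arc_to_ends_def intro: no_multi_arcs)
  moreover have nbrs: "{u. v \<rightarrow> u} = head G ` out_arcs G v"
    by (auto simp: arcs_ends_conv)
  ultimately have "card {u. v \<rightarrow> u} = out_degree G v"
    by (simp add: out_degree_def card_image)
  moreover have "finite {u. v \<rightarrow> u}"
    unfolding nbrs out_arcs_def by simp
  moreover have "v \<notin> {u. v \<rightarrow> u}"
    using adj_not_same by blast
  ultimately show ?thesis
    by (simp add: closed_nbhd_def)
qed

text \<open>At \<open>-1\<close> the characteristic matrix is A + I. Absence of loops keeps its
  diagonal entries at 1, and distinctness of \<open>vs\<close> ensures that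
  \<open>vs ! i = vs ! j\<close> happens only on the diagonal.\<close>

lemma (in loopfree_digraph) char_matrix_adjacency_matrix:
  assumes "distinct vs"
  shows "char_matrix (adjacency_matrix G vs) (-1) = map_mat of_int (closed_nbhd_matrix G vs)"
  by (rule eq_matI)
    (use assms adj_not_same in \<open>auto simp: char_matrix_def adjacency_matrix_def
      closed_nbhd_matrix_def closed_nbhd_def nth_eq_iff_index_eq\<close>)

text \<open>The determinant commutes with the injective embedding of the integers into the reals, so
  singularity can be tested over the integers.\<close>

lemma (in loopfree_digraph) eigenvalue_adjacency_matrix_iff:
  assumes "distinct vs"
  shows "eigenvalue (adjacency_matrix G vs) (-1) \<longleftrightarrow> det (closed_nbhd_matrix G vs) = 0"
proof -
  have "adjacency_matrix G vs \<in> carrier_mat (length vs) (length vs)"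
    by (simp add: adjacency_matrix_def)
  then show ?thesis
    by (simp add: eigenvalue_det char_matrix_adjacency_matrix[OF assms] of_int_hom.hom_det)
qed

lemma (in wf_digraph) closed_nbhd_matrix_mult_vec:
  assumes "distinct vs" "set vs = verts G" "i < length vs"
  shows "(closed_nbhd_matrix G vs *\<^sub>v vec (length vs) (\<lambda>j. g (vs ! j))) $ i
    = (\<Sum>u \<in> closed_nbhd G (vs ! i). g u)"
proof -
  let ?N = "closed_nbhd G (vs ! i)"
  have sub: "?N \<subseteq> set vs"
    using assms closed_nbhd_subset_verts by (metis nth_mem)
  have "(closed_nbhd_matrix G vs *\<^sub>v vec (length vs) (\<lambda>j. g (vs ! j))) $ i
    = (\<Sum>j<length vs. if vs ! j \<in> ?N then g (vs ! j) else 0)"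
    using assms(3)
    by (auto simp: closed_nbhd_matrix_def scalar_prod_def atLeast0LessThan intro: sum.cong)
  also have "\<dots> = (\<Sum>u \<in> set vs. if u \<in> ?N then g u else 0)"
    by (rule sum.reindex_bij_betw[OF bij_betw_nth[OF assms(1) refl refl]])
  also have "\<dots> = (\<Sum>u \<in> ?N. g u)"
    using sub by (simp add: sum.inter_restrict[symmetric] Int_absorb1)
  finally show ?thesis .
qed

text \<open>A singular matrix over an integral domain has a nonzero kernel vector with entries in
  that same domain, so the integer matrix yields integer values directly. The rest translates
  between vectors indexed by positions in \<open>vs\<close> and functions on vertices.\<close>

lemma (in wf_digraph) det_closed_nbhd_matrix_eq_0_iff:
  assumes "distinct vs" "set vs = verts G"
  shows "det (closed_nbhd_matrix G vs) = 0 \<longleftrightarrow>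
    (\<exists>g :: 'a \<Rightarrow> int. (\<exists>v \<in> verts G. g v \<noteq> 0) \<and>
      (\<forall>v \<in> verts G. (\<Sum>u \<in> closed_nbhd G v. g u) = 0))"
    (is "_ \<longleftrightarrow> (\<exists>g. ?P g)")
proof -
  let ?n = "length vs" and ?M = "closed_nbhd_matrix G vs"
  let ?Q = "\<lambda>x. x \<in> carrier_vec ?n \<and> x \<noteq> 0\<^sub>v ?n \<and> ?M *\<^sub>v x = 0\<^sub>v ?n"
  have vec_iff: "?Q (vec ?n (\<lambda>j. g (vs ! j))) \<longleftrightarrow> ?P g" for g
  proof -
    have "vec ?n (\<lambda>j. g (vs ! j)) = 0\<^sub>v ?n \<longleftrightarrow> (\<forall>v \<in> verts G. g v = 0)"
      unfolding assms(2)[symmetric] by (simp add: vec_eq_iff all_set_conv_all_nth)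
    moreover have "?M *\<^sub>v vec ?n (\<lambda>j. g (vs ! j)) = 0\<^sub>v ?n
        \<longleftrightarrow> (\<forall>i < ?n. (\<Sum>u \<in> closed_nbhd G (vs ! i). g u) = 0)"
      using closed_nbhd_matrix_mult_vec[OF assms, of _ g]
        carrier_matD(1)[OF closed_nbhd_matrix_carrier[of G vs]]
      by (auto simp del: index_mult_mat_vec simp: vec_eq_iff)
    moreover have "\<dots> \<longleftrightarrow> (\<forall>v \<in> verts G. (\<Sum>u \<in> closed_nbhd G v. g u) = 0)"
      unfolding assms(2)[symmetric] by (simp add: all_set_conv_all_nth)
    ultimately show ?thesis
      by auto
  qed
  have "\<exists>g. x = vec ?n (\<lambda>j. g (vs ! j))" if "x \<in> carrier_vec ?n" for x :: "int vec"
  proof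
    \<comment> \<open>The witness looks up the position of \<open>v\<close> in \<open>vs\<close> and
      reads off that entry of \<open>x\<close>; its values off \<open>vs\<close> do not
      matter.\<close>
    show "x = vec ?n (\<lambda>j. (\<lambda>v. x $ the_inv_into {..<?n} ((!) vs) v) (vs ! j))"
      using that assms(1)
      by (auto simp: vec_eq_iff the_inv_into_f_f inj_on_nth)
  qed
  then have "(\<exists>x. ?Q x) \<longleftrightarrow> (\<exists>g. ?Q (vec ?n (\<lambda>j. g (vs ! j))))"
    by blast
  then show ?thesis
    unfolding vec_iff by (simp add: det_0_iff_vec_prod_zero[OF closed_nbhd_matrix_carrier])
qed

lemma (in digraph) sum_closed_nbhd_const:
  assumes "regular G r" "v \<in> verts G"
  shows "(\<Sum>u \<in> closed_nbhd G v. c) = int (Suc r) * c"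
  using assms by (simp add: card_closed_nbhd regular_def)

lemma (in digraph) integral_kernel_of_efficient_dominating_function:
  assumes reg: "regular G r"
    and eff: "efficient_dominating_function G j k f" and nontriv: "\<not> trivial_function G f"
  shows "\<exists>g :: 'a \<Rightarrow> int. (\<exists>v \<in> verts G. g v \<noteq> 0) \<and>
    (\<forall>v \<in> verts G. (\<Sum>u \<in> closed_nbhd G v. g u) = 0)"
proof (intro exI conjI ballI)
  let ?g = "\<lambda>v. int (Suc r) * int (f v) - int k"
  show "\<exists>v \<in> verts G. ?g v \<noteq> 0"
  proof (rule ccontr)
    assume "\<not> ?thesis"
    \<comment> \<open>If \<open>?g\<close> vanishes everywhere, then (r + 1) f(v) = k at every
      vertex, which determines f(v).\<close>
    then have "f v = k div Suc r" if "v \<in> verts G" for v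
      using that by (metis nonzero_mult_div_cancel_left of_nat_eq_iff of_nat_mult
        right_minus_eq nat.distinct(1))
    then show False
      using nontriv by (auto simp: trivial_function_def)
  qed
  fix v assume v: "v \<in> verts G"
  have "(\<Sum>u \<in> closed_nbhd G v. ?g u)
    = int (Suc r) * int (\<Sum>u \<in> closed_nbhd G v. f u) - (\<Sum>u \<in> closed_nbhd G v. int k)"
    by (simp only: sum_subtractf sum_distrib_left of_nat_sum)
  also have "\<dots> = 0"
    using eff v
    by (simp only: sum_closed_nbhd_const[OF reg v]) (simp add: efficient_dominating_function_def)
  finally show "(\<Sum>u \<in> closed_nbhd G v. ?g u) = 0" .
qed

lemma (in digraph) efficient_dominating_function_of_integral_kernel:
  fixes g :: "'a \<Rightarrow> int"
  assumes reg: "regular G r"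
    and nz: "\<exists>v \<in> verts G. g v \<noteq> 0"
    and ker: "\<And>v. v \<in> verts G \<Longrightarrow> (\<Sum>u \<in> closed_nbhd G v. g u) = 0"
  shows "\<exists>j k f. k \<ge> 1 \<and> efficient_dominating_function G j k f \<and> \<not> trivial_function G f"
proof -
  \<comment> \<open>This \<open>m\<close> bounds |g| on all vertices, so g + m takes values between
    0 and 2m and \<open>nat\<close> truncates nothing there. It is positive because g is nonzero
    somewhere, which makes k = (r + 1) m positive.\<close>
  define m where "m = (\<Sum>v \<in> verts G. nat \<bar>g v\<bar>)"
  define f where "f v = nat (g v + int m)" for v
  obtain w where w: "w \<in> verts G" "g w \<noteq> 0"
    using nz by blast
  have le_m: "nat \<bar>g v\<bar> \<le> m" if "v \<in> verts G" for v
    unfolding m_def using that by (intro member_le_sum) auto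
  have int_f: "int (f v) = g v + int m" if "v \<in> verts G" for v
    using le_m[OF that] by (simp add: f_def)
  have "f v \<le> 2 * m" if "v \<in> verts G" for v
    using le_m[OF that] by (simp add: f_def)
  moreover have "(\<Sum>u \<in> closed_nbhd G v. f u) = Suc r * m" if v: "v \<in> verts G" for v
  proof -
    have "int (\<Sum>u \<in> closed_nbhd G v. f u) = (\<Sum>u \<in> closed_nbhd G v. g u + int m)"
      using closed_nbhd_subset_verts[OF v] by (auto simp: int_f intro!: sum.cong)
    also have "\<dots> = int (Suc r * m)"
      by (simp only: sum.distrib ker[OF v] sum_closed_nbhd_const[OF reg v]) (simp add: algebra_simps)
    finally show ?thesis
      by (simp only: of_nat_eq_iff)
  qed
  ultimately have "efficient_dominating_function G (2 * m) (Suc r * m) f"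
    by (simp add: efficient_dominating_function_def dominating_function_def)
  moreover have "Suc r * m \<ge> 1"
    using le_m[OF w(1)] w(2) by (cases m) auto
  moreover have "\<not> trivial_function G f"
  proof
    \<comment> \<open>A constant \<open>f\<close> would make \<open>g\<close> constant, so its sum
      over a closed neighbourhood would be (r + 1) g(w), which is nonzero.\<close>
    assume "trivial_function G f"
    then have "g v = g w" if "v \<in> verts G" for v
      using int_f that w(1) unfolding trivial_function_def by (metis add_right_cancel)
    then have "(\<Sum>u \<in> closed_nbhd G w. g u) = (\<Sum>u \<in> closed_nbhd G w. g w)"
      using closed_nbhd_subset_verts[OF w(1)] by (intro sum.cong) auto
    then show False
      using ker[OF w(1)] sum_closed_nbhd_const[OF reg w(1)] w(2) by simp
  qed
  ultimately show ?thesis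
    by blast
qed

theorem theorem3p5:
  fixes X :: "('a, 'b) pre_digraph" and r :: nat and vs :: "'a list"
  assumes "graph X"
    and "regular X r"
    and "distinct vs" and "set vs = verts X"
  shows "(\<exists>j k f. k \<ge> 1 \<and> efficient_dominating_function X j k f \<and> \<not> trivial_function X f)
    \<longleftrightarrow> eigenvalue (adjacency_matrix X vs) (-1)"
proof -
  interpret graph X by fact
  show ?thesis
    unfolding eigenvalue_adjacency_matrix_iff[OF assms(3)]
      det_closed_nbhd_matrix_eq_0_iff[OF assms(3,4)]
  proof
    assume "\<exists>j k f. k \<ge> 1 \<and> efficient_dominating_function X j k f \<and> \<not> trivial_function X f"
    then show "\<exists>g :: 'a \<Rightarrow> int. (\<exists>v \<in> verts X. g v \<noteq> 0) \<and>
        (\<forall>v \<in> verts X. (\<Sum>u \<in> closed_nbhd X v. g u) = 0)"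
      by (elim exE conjE) (rule integral_kernel_of_efficient_dominating_function[OF assms(2)])
  next
    assume "\<exists>g :: 'a \<Rightarrow> int. (\<exists>v \<in> verts X. g v \<noteq> 0) \<and>
        (\<forall>v \<in> verts X. (\<Sum>u \<in> closed_nbhd X v. g u) = 0)"
    then show "\<exists>j k f. k \<ge> 1 \<and> efficient_dominating_function X j k f \<and> \<not> trivial_function X f"
      by (elim exE conjE) (rule efficient_dominating_function_of_integral_kernel[OF assms(2)], auto)
  qed
qed

end
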